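(* Let $n\ge1$, let $P$ be a finite partially ordered set, let $R$ be a partially ordered set, and let $\phi:[n]\times P\to R$ be an isotone map such that the fibers $\phi^{-1}(r)$, $r\in R$, are bistrict chains in $[n]\times P^{op}$. Then the ideals $L^{\phi}(n,P)$ and $L^{\phi^\tau}(P,n)$ in $\Bbbk[x_R]$ are Alexander dual.
   Context: $\Bbbk$ is a field and $[n]=\{1<2<\cdots<n\}$ is the chain on $n$ elements. For a set $A$, $\Bbbk[x_A]$ is the polynomial ring in variables $x_a$, $a\in A$. A map of posets is isotone if it is order preserving; $\mathrm{Hom}(P,[n])$ is the set of isotone maps $P\to[n]$. Products of posets carry the componentwise order, and $P^{op}$ is the opposite poset of $P$. $L(n,P)\subseteq\Bbbk[x_{[n]\times P}]$ is the ideal generated by all monomials $x_{1,p_1}x_{2,p_2}\cdots x_{n,p_n}$ with $p_1\le\cdots\le p_n$ in $P$. $L(P,n)\subseteq\Bbbk[x_{P\times[n]}]$ is the ideal generated by all monomials $\prod_{p\in P}x_{p,\psi(p)}$ with $\psi\in\mathrm{Hom}(P,[n])$. $\phi^\tau:P\times[n]\to R$ is the map $\phi^\tau(p,i)=\phi(i,p)$. $L^\phi(n,P)$ is the ideal of $\Bbbk[x_R]$ generated by the image of $L(n,P)$ under the $\Bbbk$-algebra map $x_{i,p}\mapsto x_{\phi(i,p)}$, and $L^{\phi^\tau}(P,n)$ is the ideal of $\Bbbk[x_R]$ generated by the image of $L(P,n)$ under $x_{p,i}\mapsto x_{\phi(i,p)}$. A chain in a product of posets $Q\times Q'$ is bistrict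 if for any two of its elements, $(a,b)<(a',b')$ implies both $a<a'$ and $b<b'$ (the latter in $Q'$). The Alexander dual of a squarefree monomial ideal $I\subseteq\Bbbk[x_R]$ is the monomial ideal of $\Bbbk[x_R]$ whose monomials are those having a nontrivial common divisor with every monomial in $I$. *)

theory Defs
  imports
    "HOL-Library.Poly_Mapping"
    "HOL-Library.Product_Order"
    "HOL-Library.Dual_Ordered_Lattice"
    "HOL-Algebra.Divisibility"
    "HOL-Algebra.Ideal"
begin

section \<open>Polynomial rings over arbitrary sets of variables\<close>

text \<open>
  A monomial is a finitely supported exponent function \<open>'a \<Rightarrow>\<^sub>0 nat\<close>, and a polynomial is a
  finitely supported coefficient function on monomials; multiplication is convolution.
\<close>

type_synonym ('a, 'k) mpoly = "('a \<Rightarrow>\<^sub>0 nat) \<Rightarrow>\<^sub>0 'k"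

text \<open>
  The polynomial ring \<open>k[x_A]\<close>, where the field \<open>k\<close> is the type \<open>'k\<close>. The set of variables
  may be a proper subset of its type (and may be empty), so that ideals, divisors and units
  have to be taken relative to this carrier.
\<close>

definition mpoly_ring :: "'a set \<Rightarrow> ('a, 'k::field) mpoly ring" where
  "mpoly_ring A =
    \<lparr>carrier = {f. \<forall>m \<in> Poly_Mapping.keys f. Poly_Mapping.keys m \<subseteq> A},
     mult = (*), one = 1, zero = 0, add = (+)\<rparr>"

definition mpoly_var :: "'a \<Rightarrow> ('a, 'k::field) mpoly" where
  "mpoly_var a = Poly_Mapping.single (Poly_Mapping.single a 1) 1"

definition mpoly_const :: "'k \<Rightarrow> ('a, 'k::field) mpoly" where
  "mpoly_const c = Poly_Mapping.single 0 c"

definition monomials :: "'a set \<Rightarrow> ('a, 'k::field) mpoly set" where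
  "monomials A = {Poly_Mapping.single m 1 | m. Poly_Mapping.keys m \<subseteq> A}"

definition squarefree_monomials :: "'a set \<Rightarrow> ('a, 'k::field) mpoly set" where
  "squarefree_monomials A =
    {Poly_Mapping.single m 1 | m.
       Poly_Mapping.keys m \<subseteq> A \<and> (\<forall>a. Poly_Mapping.lookup m a \<le> 1)}"

text \<open>The algebra homomorphism over \<open>k\<close> with \<open>x_a \<mapsto> x_(f a)\<close>.\<close>

definition mpoly_rename :: "('a \<Rightarrow> 'b) \<Rightarrow> ('a, 'k::field) mpoly \<Rightarrow> ('b, 'k) mpoly" where
  "mpoly_rename f q =
    (\<Sum>m \<in> Poly_Mapping.keys q. mpoly_const (Poly_Mapping.lookup q m) *
       (\<Prod>a \<in> Poly_Mapping.keys m. mpoly_var (f a) ^ Poly_Mapping.lookup m a))"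

lemma cring_mpoly_ring: "cring (mpoly_ring A :: ('a, 'k::field) mpoly ring)"
proof -
  let ?M = "mpoly_ring A :: ('a, 'k) mpoly ring"
  have mult: "f * g \<in> carrier ?M" if f: "f \<in> carrier ?M" and g: "g \<in> carrier ?M" for f g
  proof -
    have "Poly_Mapping.keys m \<subseteq> A" if "m \<in> Poly_Mapping.keys (f * g)" for m
    proof -
      from that obtain m1 m2 where m: "m = m1 + m2"
          and "m1 \<in> Poly_Mapping.keys f" "m2 \<in> Poly_Mapping.keys g"
        using keys_mult[of f g] by blast
      then have "Poly_Mapping.keys m1 \<subseteq> A" "Poly_Mapping.keys m2 \<subseteq> A"
        using f g by (simp_all add: mpoly_ring_def)
      then show ?thesis
        unfolding m using Poly_Mapping.keys_add[of m1 m2] by blast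
    qed
    then show ?thesis
      by (simp add: mpoly_ring_def)
  qed
  have add: "f + g \<in> carrier ?M" if f: "f \<in> carrier ?M" and g: "g \<in> carrier ?M" for f g
  proof -
    have "Poly_Mapping.keys m \<subseteq> A" if "m \<in> Poly_Mapping.keys (f + g)" for m
    proof -
      have "m \<in> Poly_Mapping.keys f \<or> m \<in> Poly_Mapping.keys g"
        using that Poly_Mapping.keys_add[of f g] by blast
      then show ?thesis
        using f g by (auto simp: mpoly_ring_def)
    qed
    then show ?thesis
      by (simp add: mpoly_ring_def)
  qed
  have uminus: "- f \<in> carrier ?M" if "f \<in> carrier ?M" for f
    using that by (simp add: mpoly_ring_def)
  have zero: "0 \<in> carrier ?M" and one: "1 \<in> carrier ?M"
    by (simp_all add: mpoly_ring_def)
  have ops: "x \<otimes>\<^bsub>?M\<^esub> y = x * y" "x \<oplus>\<^bsub>?M\<^esub> y = x + y" "\<one>\<^bsub>?M\<^esub> = 1" "\<zero>\<^bsub>?M\<^esub> = 0" for x y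
    by (simp_all add: mpoly_ring_def)
  show ?thesis
  proof (rule cringI)
    show "abelian_group ?M"
    proof (rule abelian_groupI, unfold ops)
      fix f assume "f \<in> carrier ?M"
      then show "\<exists>g\<in>carrier ?M. g + f = 0"
        by (intro bexI[of _ "- f"]) (simp_all add: uminus)
    qed (simp_all add: zero add add.assoc add.commute)
    show "comm_monoid ?M"
      by (rule comm_monoidI, unfold ops) (simp_all add: one mult mult.assoc mult.commute)
  qed (simp only: ops distrib_right)
qed


section \<open>Alexander duality\<close>

definition monomial_ideal :: "'a set \<Rightarrow> ('a, 'k::field) mpoly set \<Rightarrow> bool" where
  "monomial_ideal A I \<longleftrightarrow> (\<exists>G \<subseteq> monomials A. I = Idl\<^bsub>mpoly_ring A\<^esub> G)"

definition squarefree_monomial_ideal :: "'a set \<Rightarrow> ('a, 'k::field) mpoly set \<Rightarrow> bool" where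
  "squarefree_monomial_ideal A I \<longleftrightarrow> (\<exists>G \<subseteq> squarefree_monomials A. I = Idl\<^bsub>mpoly_ring A\<^esub> G)"

definition nontrivial_common_divisor ::
    "'a set \<Rightarrow> ('a, 'k::field) mpoly \<Rightarrow> ('a, 'k) mpoly \<Rightarrow> bool" where
  "nontrivial_common_divisor A u v \<longleftrightarrow>
    (\<exists>d \<in> carrier (mpoly_ring A). d \<notin> Units (mpoly_ring A) \<and>
       d divides\<^bsub>mpoly_ring A\<^esub> u \<and> d divides\<^bsub>mpoly_ring A\<^esub> v)"

definition is_alexander_dual ::
    "'a set \<Rightarrow> ('a, 'k::field) mpoly set \<Rightarrow> ('a, 'k) mpoly set \<Rightarrow> bool" where
  "is_alexander_dual A I J \<longleftrightarrow> monomial_ideal A J \<and>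
    J \<inter> monomials A =
      {u \<in> monomials A. \<forall>v \<in> I \<inter> monomials A. nontrivial_common_divisor A u v}"

text \<open>
  The Alexander dual is defined for squarefree monomial ideals, and two ideals are called
  Alexander dual if each is the Alexander dual of the other.
\<close>

definition alexander_dual_pair ::
    "'a set \<Rightarrow> ('a, 'k::field) mpoly set \<Rightarrow> ('a, 'k) mpoly set \<Rightarrow> bool" where
  "alexander_dual_pair A I J \<longleftrightarrow>
    squarefree_monomial_ideal A I \<and> squarefree_monomial_ideal A J \<and>
    is_alexander_dual A I J \<and> is_alexander_dual A J I"


section \<open>Letterplace and co-letterplace ideals\<close>

text \<open>The chain \<open>[n]\<close> is \<open>{1..n}\<close>, and a poset is a subset of a type of class \<open>order\<close>.\<close>

definition poset_Hom :: "'p::order set \<Rightarrow> 'q::order set \<Rightarrow> ('p \<Rightarrow> 'q) set" where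
  "poset_Hom P Q = {\<psi> \<in> P \<rightarrow> Q. mono_on P \<psi>}"

definition letterplace_ideal :: "nat \<Rightarrow> 'p::order set \<Rightarrow> (nat \<times> 'p, 'k::field) mpoly set" where
  "letterplace_ideal n P =
    Idl\<^bsub>mpoly_ring ({1..n} \<times> P)\<^esub>
      {\<Prod>i\<in>{1..n}. mpoly_var (i, p i) | p. p \<in> poset_Hom {1..n} P}"

definition coletterplace_ideal :: "'p::order set \<Rightarrow> nat \<Rightarrow> ('p \<times> nat, 'k::field) mpoly set" where
  "coletterplace_ideal P n =
    Idl\<^bsub>mpoly_ring (P \<times> {1..n})\<^esub>
      {\<Prod>p\<in>P. mpoly_var (p, \<psi> p) | \<psi>. \<psi> \<in> poset_Hom P {1..n}}"

definition extended_ideal ::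
    "'b set \<Rightarrow> ('a \<Rightarrow> 'b) \<Rightarrow> ('a, 'k::field) mpoly set \<Rightarrow> ('b, 'k) mpoly set" where
  "extended_ideal R f I = Idl\<^bsub>mpoly_ring R\<^esub> (mpoly_rename f ` I)"

definition transpose_map :: "('a \<times> 'b \<Rightarrow> 'c) \<Rightarrow> 'b \<times> 'a \<Rightarrow> 'c" where
  "transpose_map \<phi> = (\<lambda>(b, a). \<phi> (a, b))"

definition bistrict_chain :: "('a::order \<times> 'b::order) set \<Rightarrow> bool" where
  "bistrict_chain C \<longleftrightarrow> Complete_Partial_Order.chain (\<le>) C \<and>
    (\<forall>(a, b) \<in> C. \<forall>(a', b') \<in> C. (a, b) < (a', b') \<longrightarrow> a < a' \<and> b < b')"

text \<open>
  The fiber of \<open>\<phi> : [n] \<times> P \<rightarrow> R\<close> over \<open>r\<close>, regarded as a subset of the product of \<open>[n]\<close> with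
  the opposite poset of \<open>P\<close>; the type constructor \<open>dual\<close> reverses the order.
\<close>

definition op_fiber :: "nat \<Rightarrow> 'p::order set \<Rightarrow> (nat \<times> 'p \<Rightarrow> 'r) \<Rightarrow> 'r \<Rightarrow> (nat \<times> 'p dual) set" where
  "op_fiber n P \<phi> r = {(i, dual p) | i p. i \<in> {1..n} \<and> p \<in> P \<and> \<phi> (i, p) = r}"

end

theory Submission
  imports Defs
begin

text \<open>
  A squarefree monomial ideal is described by the sets of variables of its generators, and a
  monomial lies in it exactly if its own set of variables contains one of these sets. Two monomials
  have a nontrivial common divisor exactly if their sets of variables meet. Alexander duality
  of two ideals is therefore a statement about two families of finite subsets of \<open>R\<close>: a subset of
  \<open>R\<close> contains a member of one family if and only if it meets every member of the other
  (\<open>alexander_dual_pairI\<close>; one direction of the symmetric requirement is obtained by passing to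
  complements).

  For the two ideals at hand the families are the images under \<open>\<phi>\<close> of the graphs of the isotone
  maps \<open>p : [n] \<rightarrow> P\<close> and of the transposed graphs of the isotone maps \<open>\<psi> : P \<rightarrow> [n]\<close>. Since the
  fibers are bistrict chains in \<open>[n] \<times> P\<^sup>o\<^sup>p\<close>, the map \<open>\<phi>\<close> is injective on each of these
  graphs: along a graph the coordinates move weakly in the same direction, along a fiber
  strictly in opposite directions. Consequently substituting variables turns each generator
  into a squarefree monomial again.

  What remains is combinatorics in \<open>[n] \<times> P\<close>, applied to the preimage under \<open>\<phi>\<close> of a subset of
  \<open>R\<close>. Two graphs always meet, because the isotone map \<open>\<psi> \<circ> p\<close> of the chain \<open>[n]\<close> has a fixed
  point. Conversely, suppose that \<open>T\<close> meets the graph of every \<open>p\<close>. The sets \<open>U\<^sub>i\<close> of the elements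
  above the end of some chain \<open>p\<^sub>1 \<le> \<dots> \<le> p\<^sub>i\<close> whose graph avoids \<open>T\<close> are up-sets that decrease from
  \<open>U\<^sub>0 = P\<close> to \<open>U\<^sub>n = {}\<close>, and \<open>\<psi>(q)\<close>, the first \<open>i\<close> with \<open>q \<notin> U\<^sub>i\<close>, is an isotone map whose graph lies
  in \<open>T\<close> (\<open>hitting_set_contains_graph\<close>).
\<close>

section \<open>Factors of monomials\<close>

text \<open>
  Once the terms at \<open>k\<close> and \<open>l\<close> are split off from \<open>f\<close> and \<open>g\<close>, no other partial product reaches
  the exponent \<open>k + l\<close>.
\<close>

lemma lookup_mult_unique_sum:
  fixes f g :: "'a::cancel_comm_monoid_add \<Rightarrow>\<^sub>0 'k::comm_ring_1"
  assumes k: "k \<in> Poly_Mapping.keys f" and l: "l \<in> Poly_Mapping.keys g"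
    and uniq: "\<And>k' l'. k' \<in> Poly_Mapping.keys f \<Longrightarrow> l' \<in> Poly_Mapping.keys g \<Longrightarrow>
      k' + l' = k + l \<Longrightarrow> k' = k \<and> l' = l"
  shows "Poly_Mapping.lookup (f * g) (k + l) = Poly_Mapping.lookup f k * Poly_Mapping.lookup g l"
proof -
  define f0 where "f0 = Poly_Mapping.single k (Poly_Mapping.lookup f k)"
  define g0 where "g0 = Poly_Mapping.single l (Poly_Mapping.lookup g l)"
  have kf0: "Poly_Mapping.keys f0 \<subseteq> {k}" and kg0: "Poly_Mapping.keys g0 \<subseteq> {l}"
    by (simp_all add: f0_def g0_def)
  have kf: "Poly_Mapping.keys (f - f0) \<subseteq> Poly_Mapping.keys f - {k}"
    by (auto simp: f0_def in_keys_iff lookup_minus lookup_single when_def split: if_splits)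
  have kg: "Poly_Mapping.keys (g - g0) \<subseteq> Poly_Mapping.keys g - {l}"
    by (auto simp: g0_def in_keys_iff lookup_minus lookup_single when_def split: if_splits)
  have "k + l \<notin> Poly_Mapping.keys (f0 * (g - g0))"
    using keys_mult[of f0 "g - g0"] kf0 kg uniq k by fastforce
  moreover have "k + l \<notin> Poly_Mapping.keys ((f - f0) * g)"
    using keys_mult[of "f - f0" g] kf uniq by fastforce
  moreover have "f * g = f0 * g0 + f0 * (g - g0) + (f - f0) * g"
    by (simp add: algebra_simps)
  ultimately show ?thesis
    by (simp add: lookup_add in_keys_iff) (simp add: f0_def g0_def mult_single)
qed

text \<open>The weights are powers of \<open>N\<close>, so that a bounded vector is recovered from its digits.\<close>

lemma separating_weights:
  assumes "finite V"
  shows "\<exists>w :: 'a \<Rightarrow> nat. \<forall>x y. (\<forall>a\<in>V. x a < N \<and> y a < N) \<longrightarrow>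
    (\<Sum>a\<in>V. w a * x a) = (\<Sum>a\<in>V. w a * y a) \<longrightarrow> (\<forall>a\<in>V. x a = y a)"
  using assms
proof (induction V)
  case empty
  show ?case by simp
next
  case (insert b V)
  then obtain w :: "'a \<Rightarrow> nat" where w: "\<And>x y. (\<forall>a\<in>V. x a < N \<and> y a < N) \<Longrightarrow>
    (\<Sum>a\<in>V. w a * x a) = (\<Sum>a\<in>V. w a * y a) \<Longrightarrow> (\<forall>a\<in>V. x a = y a)"
    by blast
  define w' where "w' = (\<lambda>a. if a = b then 1 else N * w a)"
  have w'_sum: "(\<Sum>a\<in>insert b V. w' a * x a) = x b + N * (\<Sum>a\<in>V. w a * x a)" for x
  proof -
    have "(\<Sum>a\<in>V. w' a * x a) = (\<Sum>a\<in>V. N * (w a * x a))"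
      using insert.hyps by (intro sum.cong) (auto simp: w'_def)
    then show ?thesis
      using insert.hyps by (simp add: w'_def sum_distrib_left)
  qed
  have "\<forall>a\<in>insert b V. x a = y a"
    if less: "\<forall>a\<in>insert b V. x a < N \<and> y a < N"
      and eq: "(\<Sum>a\<in>insert b V. w' a * x a) = (\<Sum>a\<in>insert b V. w' a * y a)" for x y
  proof -
    have eq': "x b + N * (\<Sum>a\<in>V. w a * x a) = y b + N * (\<Sum>a\<in>V. w a * y a)"
      using eq unfolding w'_sum .
    have "x b < N" "y b < N"
      using less by auto
    then have "x b = y b"
      using arg_cong[OF eq', of "\<lambda>t. t mod N"] by simp
    then have "(\<Sum>a\<in>V. w a * x a) = (\<Sum>a\<in>V. w a * y a)"
      using eq' \<open>x b < N\<close> by simp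
    then show ?thesis
      using w[of x y] less \<open>x b = y b\<close> by blast
  qed
  then show ?case by blast
qed

text \<open>
  Such a weight orders the finitely many monomials under consideration compatibly with their
  multiplication. It serves as a monomial order that needs no order on the variables.
\<close>

lemma additive_injection_on_finite:
  assumes "finite (K :: ('a \<Rightarrow>\<^sub>0 nat) set)"
  shows "\<exists>\<nu> :: ('a \<Rightarrow>\<^sub>0 nat) \<Rightarrow> nat. (\<forall>m m'. \<nu> (m + m') = \<nu> m + \<nu> m') \<and> inj_on \<nu> K"
proof -
  define V where "V = (\<Union>m\<in>K. Poly_Mapping.keys m)"
  have V: "finite V"
    using assms by (simp add: V_def)
  have "finite ((\<lambda>(m, a). Poly_Mapping.lookup m a) ` (K \<times> V))"
    using assms V by blast
  then obtain N where "\<forall>x\<in>(\<lambda>(m, a). Poly_Mapping.lookup m a) ` (K \<times> V). x < N"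
    unfolding finite_nat_set_iff_bounded by blast
  then have N: "Poly_Mapping.lookup m a < N" if "m \<in> K" "a \<in> V" for m a
    using that by auto
  obtain w :: "'a \<Rightarrow> nat" where w: "\<And>x y. (\<forall>a\<in>V. x a < N \<and> y a < N) \<Longrightarrow>
    (\<Sum>a\<in>V. w a * x a) = (\<Sum>a\<in>V. w a * y a) \<Longrightarrow> (\<forall>a\<in>V. x a = y a)"
    using separating_weights[OF V, of N] by blast
  define \<nu> where "\<nu> m = (\<Sum>a\<in>V. w a * Poly_Mapping.lookup m a)" for m
  have "inj_on \<nu> K"
  proof (rule inj_onI)
    fix m m' assume m: "m \<in> K" "m' \<in> K" and "\<nu> m = \<nu> m'"
    then have "\<forall>a\<in>V. Poly_Mapping.lookup m a = Poly_Mapping.lookup m' a"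
      using N unfolding \<nu>_def by (intro w) blast+
    moreover have "Poly_Mapping.lookup m a = 0 \<and> Poly_Mapping.lookup m' a = 0" if "a \<notin> V" for a
      using that m by (auto simp: V_def in_keys_iff)
    ultimately show "m = m'"
      by (intro poly_mapping_eqI) metis
  qed
  moreover have "\<nu> (m + m') = \<nu> m + \<nu> m'" for m m'
    by (simp add: \<nu>_def lookup_add distrib_left sum.distrib)
  ultimately show ?thesis
    by blast
qed

text \<open>
  The products of the two heaviest and of the two lightest terms of the factors cannot cancel.
  In a product with only one term they coincide, so all terms of a factor have the same weight,
  and as the weight is injective there is only one.
\<close>

lemma factor_of_monomial:
  fixes d e :: "('a, 'k::field) mpoly"
  assumes de: "d * e = Poly_Mapping.single m 1"
  obtains k c l where "d = Poly_Mapping.single k c" "c \<noteq> 0" "m = k + l"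
proof -
  let ?D = "Poly_Mapping.keys d" and ?E = "Poly_Mapping.keys e"
  have "d * e \<noteq> 0"
    by (metis de lookup_single_eq lookup_zero zero_neq_one)
  then have "d \<noteq> 0" "e \<noteq> 0"
    by auto
  then have ne: "?D \<noteq> {}" "?E \<noteq> {}"
    by simp_all
  obtain \<nu> :: "('a \<Rightarrow>\<^sub>0 nat) \<Rightarrow> nat"
    where \<nu>: "(\<forall>m m'. \<nu> (m + m') = \<nu> m + \<nu> m') \<and> inj_on \<nu> (?D \<union> ?E)"
    using additive_injection_on_finite[OF finite_UnI[OF finite_keys finite_keys]] by (rule exE)
  then have add: "\<nu> (m + m') = \<nu> m + \<nu> m'" and inj: "inj_on \<nu> (?D \<union> ?E)" for m m'
    by simp_all
  have extremal: "k + l = m"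
    if k: "k \<in> ?D" and l: "l \<in> ?E"
      and "\<And>k' l'. k' \<in> ?D \<Longrightarrow> l' \<in> ?E \<Longrightarrow> \<nu> k' + \<nu> l' = \<nu> k + \<nu> l \<Longrightarrow>
        \<nu> k' = \<nu> k \<and> \<nu> l' = \<nu> l" for k l
  proof -
    have "Poly_Mapping.lookup (d * e) (k + l) = Poly_Mapping.lookup d k * Poly_Mapping.lookup e l"
    proof (rule lookup_mult_unique_sum[OF k l])
      fix k' l' assume kl: "k' \<in> ?D" "l' \<in> ?E" "k' + l' = k + l"
      then have "\<nu> k' + \<nu> l' = \<nu> k + \<nu> l"
        by (metis add)
      then have "\<nu> k' = \<nu> k \<and> \<nu> l' = \<nu> l"
        using kl that(3) by blast
      then show "k' = k \<and> l' = l"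
        using inj kl(1,2) k l by (auto dest: inj_onD)
    qed
    also have "\<dots> \<noteq> 0"
      using k l by (simp add: in_keys_iff)
    finally show ?thesis
      unfolding de by (simp add: lookup_single when_def split: if_splits)
  qed
  have ex_max: "\<exists>k\<in>K. \<forall>k'\<in>K. \<nu> k' \<le> \<nu> k" if K: "finite K" "K \<noteq> {}" for K
  proof -
    obtain k where "k \<in> K" "Max (\<nu> ` K) = \<nu> k"
      using K by (rule obtains_MAX)
    then show ?thesis
      using K by (intro bexI[of _ k]) (auto simp flip: \<open>Max (\<nu> ` K) = \<nu> k\<close>)
  qed
  have ex_min: "\<exists>k\<in>K. \<forall>k'\<in>K. \<nu> k \<le> \<nu> k'" if K: "finite K" "K \<noteq> {}" for K
  proof -
    obtain k where "k \<in> K" "Min (\<nu> ` K) = \<nu> k"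
      using K by (rule obtains_MIN)
    then show ?thesis
      using K by (intro bexI[of _ k]) (auto simp flip: \<open>Min (\<nu> ` K) = \<nu> k\<close>)
  qed
  obtain k1 where k1: "k1 \<in> ?D" "\<And>k. k \<in> ?D \<Longrightarrow> \<nu> k \<le> \<nu> k1"
    using ex_max[OF finite_keys ne(1)] by blast
  obtain l1 where l1: "l1 \<in> ?E" "\<And>l. l \<in> ?E \<Longrightarrow> \<nu> l \<le> \<nu> l1"
    using ex_max[OF finite_keys ne(2)] by blast
  obtain k0 where k0: "k0 \<in> ?D" "\<And>k. k \<in> ?D \<Longrightarrow> \<nu> k0 \<le> \<nu> k"
    using ex_min[OF finite_keys ne(1)] by blast
  obtain l0 where l0: "l0 \<in> ?E" "\<And>l. l \<in> ?E \<Longrightarrow> \<nu> l0 \<le> \<nu> l"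
    using ex_min[OF finite_keys ne(2)] by blast
  have top: "k1 + l1 = m"
  proof (rule extremal)
    fix k l assume "k \<in> ?D" "l \<in> ?E" "\<nu> k + \<nu> l = \<nu> k1 + \<nu> l1"
    then show "\<nu> k = \<nu> k1 \<and> \<nu> l = \<nu> l1"
      using k1(2)[of k] l1(2)[of l] by linarith
  qed (fact k1(1) l1(1))+
  have bot: "k0 + l0 = m"
  proof (rule extremal)
    fix k l assume "k \<in> ?D" "l \<in> ?E" "\<nu> k + \<nu> l = \<nu> k0 + \<nu> l0"
    then show "\<nu> k = \<nu> k0 \<and> \<nu> l = \<nu> l0"
      using k0(2)[of k] l0(2)[of l] by linarith
  qed (fact k0(1) l0(1))+
  have "\<nu> k1 + \<nu> l1 = \<nu> k0 + \<nu> l0"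
    by (metis add top bot)
  then have "\<nu> k1 = \<nu> k0"
    using k0(2)[OF k1(1)] l0(2)[OF l1(1)] by linarith
  then have "k = k1" if "k \<in> ?D" for k
    using that k1 k0 inj by (metis UnI1 inj_onD le_antisym)
  then have "d = Poly_Mapping.single k1 (Poly_Mapping.lookup d k1)"
    by (intro poly_mapping_eqI) (auto simp: lookup_single when_def in_keys_iff)
  then show ?thesis
    using that[of k1 "Poly_Mapping.lookup d k1" l1] k1(1) top by (simp add: in_keys_iff)
qed


section \<open>Ideals generated by squarefree monomials\<close>

lemma mpoly_ring_simps:
  "f \<in> carrier (mpoly_ring A) \<longleftrightarrow> (\<forall>m \<in> Poly_Mapping.keys f. Poly_Mapping.keys m \<subseteq> A)"
  "f \<otimes>\<^bsub>mpoly_ring A\<^esub> g = f * g" "f \<oplus>\<^bsub>mpoly_ring A\<^esub> g = f + g"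
  "\<one>\<^bsub>mpoly_ring A\<^esub> = 1" "\<zero>\<^bsub>mpoly_ring A\<^esub> = 0"
  by (simp_all add: mpoly_ring_def)

lemma keys_add_nat:
  "Poly_Mapping.keys (m + m' :: 'a \<Rightarrow>\<^sub>0 nat) = Poly_Mapping.keys m \<union> Poly_Mapping.keys m'"
  by (auto simp: in_keys_iff lookup_add)

definition squarefree_exponent :: "'a set \<Rightarrow> 'a \<Rightarrow>\<^sub>0 nat" where
  "squarefree_exponent C = (\<Sum>a\<in>C. Poly_Mapping.single a 1)"

definition variable_product :: "'a set \<Rightarrow> ('a, 'k::field) mpoly" where
  "variable_product C = (\<Prod>a\<in>C. mpoly_var a)"

lemma lookup_squarefree_exponent:
  "finite C \<Longrightarrow> Poly_Mapping.lookup (squarefree_exponent C) a = (if a \<in> C then 1 else 0)"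
  by (simp add: squarefree_exponent_def lookup_sum lookup_single when_def)

lemma keys_squarefree_exponent [simp]:
  "finite C \<Longrightarrow> Poly_Mapping.keys (squarefree_exponent C) = C"
  by (auto simp: in_keys_iff lookup_squarefree_exponent split: if_splits)

lemma prod_single:
  "(\<Prod>a\<in>C. Poly_Mapping.single (e a) (1::'k::comm_semiring_1)) =
    Poly_Mapping.single (\<Sum>a\<in>C. e a :: 'b::comm_monoid_add) 1"
  by (induction C rule: infinite_finite_induct) (simp_all add: mult_single)

lemma variable_product_eq_single:
  "variable_product C = Poly_Mapping.single (squarefree_exponent C) 1"
  by (simp add: variable_product_def squarefree_exponent_def mpoly_var_def prod_single)

lemma squarefree_exponent_divides:
  assumes "finite C" "C \<subseteq> Poly_Mapping.keys m"
  shows "squarefree_exponent C + (m - squarefree_exponent C) = m"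
proof (rule poly_mapping_eqI)
  fix a
  have "a \<in> C \<Longrightarrow> 0 < Poly_Mapping.lookup m a"
    using assms(2) by (auto simp: in_keys_iff)
  then show "Poly_Mapping.lookup (squarefree_exponent C + (m - squarefree_exponent C)) a =
      Poly_Mapping.lookup m a"
    using assms(1) by (auto simp: lookup_add lookup_minus lookup_squarefree_exponent)
qed

lemma sum_single_lookup:
  "(\<Sum>m\<in>Poly_Mapping.keys f. Poly_Mapping.single m (Poly_Mapping.lookup f m)) = f"
  by (rule poly_mapping_eqI) (auto simp: lookup_sum lookup_single when_def in_keys_iff)

lemma ideal_sum_closed:
  assumes "ideal I (mpoly_ring A :: ('a, 'k::field) mpoly ring)"
    and "\<And>x. x \<in> X \<Longrightarrow> f x \<in> I"
  shows "sum f X \<in> I"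
proof -
  interpret ideal I "mpoly_ring A :: ('a, 'k) mpoly ring"
    by (rule assms(1))
  have 0: "0 \<in> I" and add: "\<And>x y. x \<in> I \<Longrightarrow> y \<in> I \<Longrightarrow> x + y \<in> I"
    using additive_subgroup.zero_closed[OF is_additive_subgroup]
      additive_subgroup.a_closed[OF is_additive_subgroup] by (simp_all add: mpoly_ring_simps)
  from assms(2) show ?thesis
    by (induction X rule: infinite_finite_induct) (auto simp: 0 add)
qed

text \<open>
  The condition on the right-hand side describes an ideal because multiplication only enlarges
  the sets of variables of monomials. Conversely, a polynomial satisfying it is a sum of terms each
  of which is a multiple of a generator.
\<close>

theorem mem_Idl_variable_products_iff:
  fixes f :: "('a, 'k::field) mpoly"
  assumes \<C>: "\<And>C. C \<in> \<C> \<Longrightarrow> finite C \<and> C \<subseteq> A"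
  shows "f \<in> Idl\<^bsub>mpoly_ring A\<^esub> (variable_product ` \<C>) \<longleftrightarrow>
    (\<forall>m \<in> Poly_Mapping.keys f. Poly_Mapping.keys m \<subseteq> A \<and> (\<exists>C\<in>\<C>. C \<subseteq> Poly_Mapping.keys m))"
proof -
  let ?M = "mpoly_ring A :: ('a, 'k) mpoly ring"
  let ?G = "variable_product ` \<C> :: ('a, 'k) mpoly set"
  let ?J = "{f :: ('a, 'k) mpoly. \<forall>m \<in> Poly_Mapping.keys f.
    Poly_Mapping.keys m \<subseteq> A \<and> (\<exists>C\<in>\<C>. C \<subseteq> Poly_Mapping.keys m)}"
  interpret M: cring ?M
    by (rule cring_mpoly_ring)
  have mult: "f * g \<in> ?J" if f: "f \<in> ?J" and g: "g \<in> carrier ?M" for f g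
  proof -
    have "Poly_Mapping.keys m \<subseteq> A \<and> (\<exists>C\<in>\<C>. C \<subseteq> Poly_Mapping.keys m)"
      if m: "m \<in> Poly_Mapping.keys (f * g)" for m
    proof -
      from subsetD[OF keys_mult m] obtain a b
        where ab: "m = a + b" "a \<in> Poly_Mapping.keys f" "b \<in> Poly_Mapping.keys g"
        by (elim CollectE exE conjE) (rule that)
      obtain C where "C \<in> \<C>" "C \<subseteq> Poly_Mapping.keys a" "Poly_Mapping.keys a \<subseteq> A"
        using f ab(2) by blast
      moreover have "Poly_Mapping.keys b \<subseteq> A"
        using g ab(3) by (simp add: mpoly_ring_simps)
      ultimately show ?thesis
        unfolding ab(1) keys_add_nat by blast
    qed
    then show ?thesis by simp
  qed
  have "ideal ?J ?M"
  proof (rule idealI[OF M.ring_axioms])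
    have uminus: "\<ominus>\<^bsub>?M\<^esub> f = - f" if "f \<in> carrier ?M" for f
      using that by (intro M.minus_equality) (simp_all add: mpoly_ring_simps)
    show "subgroup ?J (add_monoid ?M)"
    proof (rule M.add.subgroupI)
      show "?J \<subseteq> carrier ?M"
        by (auto simp: mpoly_ring_simps)
      then have "f \<in> carrier ?M" if "f \<in> ?J" for f
        using that by (rule subsetD)
      then show "\<ominus>\<^bsub>?M\<^esub> f \<in> ?J" if "f \<in> ?J" for f
        using that uminus[of f] by simp
      show "f \<oplus>\<^bsub>?M\<^esub> g \<in> ?J" if "f \<in> ?J" "g \<in> ?J" for f g
        using that Poly_Mapping.keys_add[of f g] by (auto simp: mpoly_ring_simps)
      have "0 \<in> ?J" by simp
      then show "?J \<noteq> {}" by blast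
    qed
  next
    fix f g assume "f \<in> ?J" "g \<in> carrier ?M"
    then have "f * g \<in> ?J" "g * f \<in> ?J"
      using mult[of f g] by (simp_all only: mult.commute)
    then show "f \<otimes>\<^bsub>?M\<^esub> g \<in> ?J" "g \<otimes>\<^bsub>?M\<^esub> f \<in> ?J"
      unfolding mpoly_ring_simps .
  qed
  moreover have "?G \<subseteq> ?J"
    using \<C> by (force simp: variable_product_eq_single)
  ultimately have "Idl\<^bsub>?M\<^esub> ?G \<subseteq> ?J"
    by (rule M.genideal_minimal)
  moreover have "f \<in> Idl\<^bsub>?M\<^esub> ?G" if f: "f \<in> ?J" for f
  proof -
    have G: "?G \<subseteq> carrier ?M"
      using \<C> by (force simp: variable_product_eq_single mpoly_ring_simps)
    have I: "ideal (Idl\<^bsub>?M\<^esub> ?G) ?M"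
      by (rule M.genideal_ideal[OF G])
    have "Poly_Mapping.single m (Poly_Mapping.lookup f m) \<in> Idl\<^bsub>?M\<^esub> ?G"
      if m: "m \<in> Poly_Mapping.keys f" for m
    proof -
      obtain C where C: "C \<in> \<C>" "C \<subseteq> Poly_Mapping.keys m" and mA: "Poly_Mapping.keys m \<subseteq> A"
        using f m by blast
      let ?r = "m - squarefree_exponent C"
      have eq: "squarefree_exponent C + ?r = m"
        using C \<C> by (intro squarefree_exponent_divides) auto
      then have "Poly_Mapping.keys ?r \<subseteq> A"
        using mA by (metis keys_add_nat le_sup_iff)
      then have "variable_product C \<otimes>\<^bsub>?M\<^esub> Poly_Mapping.single ?r (Poly_Mapping.lookup f m)
          \<in> Idl\<^bsub>?M\<^esub> ?G"
        using M.genideal_self[OF G] C(1)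
        by (intro ideal.I_r_closed[OF I]) (auto simp: mpoly_ring_simps)
      then show ?thesis
        by (simp add: mpoly_ring_simps variable_product_eq_single mult_single eq)
    qed
    then have "(\<Sum>m\<in>Poly_Mapping.keys f. Poly_Mapping.single m (Poly_Mapping.lookup f m))
        \<in> Idl\<^bsub>?M\<^esub> ?G"
      by (rule ideal_sum_closed[OF I])
    then show ?thesis
      by (simp add: sum_single_lookup)
  qed
  ultimately show ?thesis by blast
qed


section \<open>Alexander duality as a statement about sets of variables\<close>

text \<open>
  A common divisor is a scalar multiple of a monomial by \<open>factor_of_monomial\<close>; if it is not a
  unit, this monomial is not constant and its variables occur in both multiples.
\<close>

lemma nontrivial_common_divisor_iff_keys_meet:
  assumes m: "Poly_Mapping.keys m \<subseteq> A" and m': "Poly_Mapping.keys m' \<subseteq> A"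
  shows "nontrivial_common_divisor A (Poly_Mapping.single m (1::'k::field)) (Poly_Mapping.single m' 1)
    \<longleftrightarrow> Poly_Mapping.keys m \<inter> Poly_Mapping.keys m' \<noteq> {}"
proof
  let ?M = "mpoly_ring A :: ('a, 'k) mpoly ring"
  assume "nontrivial_common_divisor A (Poly_Mapping.single m (1::'k)) (Poly_Mapping.single m' 1)"
  then obtain d e e' :: "('a, 'k) mpoly" where d: "d \<notin> Units ?M"
      and e: "d * e = Poly_Mapping.single m 1" "d * e' = Poly_Mapping.single m' 1"
    by (auto simp: nontrivial_common_divisor_def factor_def mpoly_ring_simps)
  from factor_of_monomial[OF e(1)] obtain k c l
    where k: "d = Poly_Mapping.single k c" "c \<noteq> 0" "m = k + l" by metis
  from factor_of_monomial[OF e(2)] obtain k' c' l'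
    where k': "d = Poly_Mapping.single k' c'" "c' \<noteq> 0" "m' = k' + l'" by metis
  have "k' = k"
    using k k' by (metis keys_single singleton_inject)
  have "k \<noteq> 0"
  proof
    assume "k = 0"
    then have "d * Poly_Mapping.single 0 (inverse c) = 1" "Poly_Mapping.single 0 (inverse c) * d = 1"
      using k by (simp_all add: mult_single)
    then have "d \<in> Units ?M"
      using \<open>k = 0\<close> k(1) unfolding Units_def mpoly_ring_simps
      by (auto intro!: exI[of _ "Poly_Mapping.single 0 (inverse c)"] simp: mpoly_ring_simps Bex_def)
    then show False
      using d by blast
  qed
  then obtain a where "a \<in> Poly_Mapping.keys k"
    using keys_eq_empty[of k] by blast
  then show "Poly_Mapping.keys m \<inter> Poly_Mapping.keys m' \<noteq> {}"
    using k(3) k'(3) \<open>k' = k\<close> by (auto simp: keys_add_nat)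
next
  let ?M = "mpoly_ring A :: ('a, 'k) mpoly ring"
  assume "Poly_Mapping.keys m \<inter> Poly_Mapping.keys m' \<noteq> {}"
  then obtain a where a: "a \<in> Poly_Mapping.keys m" "a \<in> Poly_Mapping.keys m'"
    by blast
  have div: "mpoly_var a divides\<^bsub>?M\<^esub> Poly_Mapping.single q 1"
    if q: "a \<in> Poly_Mapping.keys q" "Poly_Mapping.keys q \<subseteq> A" for q
  proof -
    have eq: "squarefree_exponent {a} + (q - squarefree_exponent {a}) = q"
      using q by (intro squarefree_exponent_divides) auto
    then have "Poly_Mapping.keys (q - squarefree_exponent {a}) \<subseteq> A"
      using q(2) by (metis keys_add_nat le_sup_iff)
    moreover have "Poly_Mapping.single q (1::'k) =
        mpoly_var a * Poly_Mapping.single (q - squarefree_exponent {a}) 1"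
      using eq by (simp add: mpoly_var_def mult_single squarefree_exponent_def)
    ultimately show ?thesis
      unfolding factor_def mpoly_ring_simps
      by (intro bexI[of _ "Poly_Mapping.single (q - squarefree_exponent {a}) 1"])
        (simp_all add: mpoly_ring_simps)
  qed
  have "mpoly_var a \<notin> Units ?M"
  proof
    assume "mpoly_var a \<in> Units ?M"
    then obtain e :: "('a, 'k) mpoly" where "mpoly_var a * e = Poly_Mapping.single 0 1"
      by (auto simp: Units_def mpoly_ring_simps)
    then obtain k l and c :: 'k where "mpoly_var a = Poly_Mapping.single k c" "c \<noteq> 0" "0 = k + l"
      by (rule factor_of_monomial)
    moreover have "Poly_Mapping.keys (mpoly_var a :: ('a, 'k) mpoly) = {Poly_Mapping.single a 1}"
      by (simp add: mpoly_var_def)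
    ultimately have "0 = Poly_Mapping.single a 1 + l"
      by simp
    then show False
      by (metis add_is_0 lookup_add lookup_single_eq lookup_zero zero_neq_one)
  qed
  moreover have "mpoly_var a \<in> carrier ?M"
    using a(1) m by (auto simp: mpoly_ring_simps mpoly_var_def)
  ultimately show "nontrivial_common_divisor A (Poly_Mapping.single m (1::'k)) (Poly_Mapping.single m' 1)"
    using div[OF a(1) m] div[OF a(2) m'] unfolding nontrivial_common_divisor_def by blast
qed

lemma squarefree_monomial_ideal_Idl_variable_products:
  assumes "\<And>C. C \<in> \<C> \<Longrightarrow> finite C \<and> C \<subseteq> A"
  shows "squarefree_monomial_ideal A
    (Idl\<^bsub>mpoly_ring A\<^esub> (variable_product ` \<C>) :: ('a, 'k::field) mpoly set)"
proof -
  have "variable_product C \<in> squarefree_monomials A" if "C \<in> \<C>" for C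
    using assms[OF that] unfolding squarefree_monomials_def
    by (auto simp: variable_product_eq_single lookup_squarefree_exponent
        intro!: exI[of _ "squarefree_exponent C"])
  then show ?thesis
    unfolding squarefree_monomial_ideal_def by blast
qed

text \<open>
  It is enough to test a monomial against the generators: every monomial of the ideal contains
  all variables of one of them.
\<close>

lemma is_alexander_dual_Idl_variable_products:
  assumes \<A>: "\<And>C. C \<in> \<A> \<Longrightarrow> finite C \<and> C \<subseteq> A" and \<B>: "\<And>C. C \<in> \<B> \<Longrightarrow> finite C \<and> C \<subseteq> A"
    and blocker: "\<And>S. S \<subseteq> A \<Longrightarrow> (\<exists>B\<in>\<B>. B \<subseteq> S) \<longleftrightarrow> (\<forall>C\<in>\<A>. C \<inter> S \<noteq> {})"
  shows "is_alexander_dual A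
    (Idl\<^bsub>mpoly_ring A\<^esub> (variable_product ` \<A>) :: ('a, 'k::field) mpoly set)
    (Idl\<^bsub>mpoly_ring A\<^esub> (variable_product ` \<B>))"
proof -
  let ?I = "Idl\<^bsub>mpoly_ring A\<^esub> (variable_product ` \<A>) :: ('a, 'k) mpoly set"
  let ?J = "Idl\<^bsub>mpoly_ring A\<^esub> (variable_product ` \<B>) :: ('a, 'k) mpoly set"
  have "u \<in> ?J \<longleftrightarrow> (\<forall>v \<in> ?I \<inter> monomials A. nontrivial_common_divisor A u v)"
    if u: "u \<in> monomials A" for u
  proof -
    obtain m where m: "u = Poly_Mapping.single m 1" "Poly_Mapping.keys m \<subseteq> A"
      using u by (auto simp: monomials_def)
    have "u \<in> ?J \<longleftrightarrow> (\<forall>C\<in>\<A>. C \<inter> Poly_Mapping.keys m \<noteq> {})"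
      using m by (simp add: mem_Idl_variable_products_iff[OF \<B>] blocker)
    also have "\<dots> \<longleftrightarrow> (\<forall>v \<in> ?I \<inter> monomials A. nontrivial_common_divisor A u v)"
    proof safe
      fix v assume hit: "\<forall>C\<in>\<A>. C \<inter> Poly_Mapping.keys m \<noteq> {}" and v: "v \<in> ?I" "v \<in> monomials A"
      then obtain q where q: "v = Poly_Mapping.single q 1" "Poly_Mapping.keys q \<subseteq> A"
        by (auto simp: monomials_def)
      then obtain C where "C \<in> \<A>" "C \<subseteq> Poly_Mapping.keys q"
        using v(1) mem_Idl_variable_products_iff[OF \<A>, of \<A> v] by auto
      then show "nontrivial_common_divisor A u v"
        using hit m q nontrivial_common_divisor_iff_keys_meet[of m A q] by blast
    next
      fix C assume all: "\<forall>v \<in> ?I \<inter> monomials A. nontrivial_common_divisor A u v"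
        and C: "C \<in> \<A>" "C \<inter> Poly_Mapping.keys m = {}"
      have fin: "finite C" "C \<subseteq> A"
        using \<A>[OF C(1)] by auto
      then have "(variable_product C :: ('a, 'k) mpoly) \<in> ?I"
        using C(1) mem_Idl_variable_products_iff[OF \<A>, of \<A> "variable_product C :: ('a, 'k) mpoly"]
        by (auto simp: variable_product_eq_single)
      moreover have "(variable_product C :: ('a, 'k) mpoly) \<in> monomials A"
        using fin by (auto simp: variable_product_eq_single monomials_def
            intro!: exI[of _ "squarefree_exponent C"])
      ultimately have "nontrivial_common_divisor A u (variable_product C)"
        using all by blast
      then show False
        using C(2) fin m nontrivial_common_divisor_iff_keys_meet[of m A "squarefree_exponent C"]
        by (auto simp: variable_product_eq_single)
    qed
    finally show ?thesis .
  qed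
  then have "?J \<inter> monomials A =
      {u \<in> monomials A. \<forall>v \<in> ?I \<inter> monomials A. nontrivial_common_divisor A u v}"
    by blast
  moreover have "squarefree_monomials A \<subseteq> (monomials A :: ('a, 'k) mpoly set)"
    by (auto simp: squarefree_monomials_def monomials_def)
  then have "monomial_ideal A ?J"
    using squarefree_monomial_ideal_Idl_variable_products[OF \<B>]
    unfolding squarefree_monomial_ideal_def monomial_ideal_def by (meson order_trans)
  ultimately show ?thesis
    unfolding is_alexander_dual_def by simp
qed

theorem alexander_dual_pairI:
  assumes \<A>: "\<And>C. C \<in> \<A> \<Longrightarrow> finite C \<and> C \<subseteq> A" and \<B>: "\<And>C. C \<in> \<B> \<Longrightarrow> finite C \<and> C \<subseteq> A"
    and meet: "\<And>C B. C \<in> \<A> \<Longrightarrow> B \<in> \<B> \<Longrightarrow> C \<inter> B \<noteq> {}"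
    and contains: "\<And>S. S \<subseteq> A \<Longrightarrow> (\<And>C. C \<in> \<A> \<Longrightarrow> C \<inter> S \<noteq> {}) \<Longrightarrow> \<exists>B\<in>\<B>. B \<subseteq> S"
  shows "alexander_dual_pair A
    (Idl\<^bsub>mpoly_ring A\<^esub> (variable_product ` \<A>) :: ('a, 'k::field) mpoly set)
    (Idl\<^bsub>mpoly_ring A\<^esub> (variable_product ` \<B>))"
proof -
  have "(\<exists>B\<in>\<B>. B \<subseteq> S) \<longleftrightarrow> (\<forall>C\<in>\<A>. C \<inter> S \<noteq> {})" if "S \<subseteq> A" for S
    using meet contains[OF that] by blast
  moreover have "(\<exists>C\<in>\<A>. C \<subseteq> S) \<longleftrightarrow> (\<forall>B\<in>\<B>. B \<inter> S \<noteq> {})" if "S \<subseteq> A" for S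
  proof
    assume "\<exists>C\<in>\<A>. C \<subseteq> S"
    then show "\<forall>B\<in>\<B>. B \<inter> S \<noteq> {}"
      using meet by blast
  next
    assume hit: "\<forall>B\<in>\<B>. B \<inter> S \<noteq> {}"
    \<comment> \<open>Otherwise the complement of \<open>S\<close> meets every \<open>C\<close>, so it contains some \<open>B\<close>, which misses \<open>S\<close>.\<close>
    show "\<exists>C\<in>\<A>. C \<subseteq> S"
    proof (rule ccontr)
      assume "\<not> (\<exists>C\<in>\<A>. C \<subseteq> S)"
      then have "\<exists>B\<in>\<B>. B \<subseteq> A - S"
        using \<A> by (intro contains) blast+
      then show False
        using hit by blast
    qed
  qed
  ultimately show ?thesis
    unfolding alexander_dual_pair_def using \<A> \<B>
    by (intro conjI squarefree_monomial_ideal_Idl_variable_products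
        is_alexander_dual_Idl_variable_products) auto
qed


section \<open>Substitution of variables\<close>

lemma mpoly_rename_eq_sum_single:
  fixes f :: "'a \<Rightarrow> 'b" and q :: "('a, 'k::field) mpoly"
  shows "mpoly_rename f q = (\<Sum>m\<in>Poly_Mapping.keys q.
    Poly_Mapping.single (\<Sum>a\<in>Poly_Mapping.keys m. Poly_Mapping.single (f a) (Poly_Mapping.lookup m a))
      (Poly_Mapping.lookup q m))"
proof -
  have pow: "mpoly_var b ^ j = Poly_Mapping.single (Poly_Mapping.single b j) (1::'k)" for b :: 'b and j
    by (induction j) (simp_all add: mpoly_var_def mult_single flip: single_add)
  show ?thesis
    unfolding mpoly_rename_def mpoly_const_def by (simp add: pow prod_single mult_single)
qed

text \<open>
  Renaming may identify variables, but exponents in \<open>nat\<close> only add up, so none of them vanishes.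
\<close>

lemma keys_renamed_exponent:
  "Poly_Mapping.keys (\<Sum>a\<in>Poly_Mapping.keys m. Poly_Mapping.single (f a) (Poly_Mapping.lookup m a))
    = f ` Poly_Mapping.keys (m :: 'a \<Rightarrow>\<^sub>0 nat)"
  by (auto simp: in_keys_iff lookup_sum lookup_single when_def split: if_splits)
    (metis in_keys_iff less_irrefl)

lemma mpoly_rename_variable_product:
  assumes "finite C" "inj_on f C"
  shows "mpoly_rename f (variable_product C) = variable_product (f ` C)"
  using assms
  by (simp add: mpoly_rename_eq_sum_single variable_product_eq_single lookup_squarefree_exponent
      squarefree_exponent_def[of "f ` C"] sum.reindex)

text \<open>
  Renaming an arbitrary element of the ideal cannot leave the ideal of the renamed generators,
  since the set of variables of a renamed monomial is the image of the original one.
\<close>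

theorem extended_ideal_Idl_variable_products:
  assumes \<C>: "\<And>C. C \<in> \<C> \<Longrightarrow> finite C \<and> C \<subseteq> X \<and> inj_on f C" and f: "f ` X \<subseteq> R"
  shows "extended_ideal R f (Idl\<^bsub>mpoly_ring X\<^esub> (variable_product ` \<C>) :: ('a, 'k::field) mpoly set)
    = Idl\<^bsub>mpoly_ring R\<^esub> (variable_product ` (`) f ` \<C>)"
proof -
  let ?X = "mpoly_ring X :: ('a, 'k) mpoly ring"
  let ?R = "mpoly_ring R :: ('b, 'k) mpoly ring"
  let ?I = "Idl\<^bsub>?X\<^esub> (variable_product ` \<C>)"
  let ?G = "variable_product ` (`) f ` \<C> :: ('b, 'k) mpoly set"
  interpret X: cring ?X by (rule cring_mpoly_ring)
  interpret R: cring ?R by (rule cring_mpoly_ring)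
  have fin: "finite C \<and> C \<subseteq> X" if "C \<in> \<C>" for C
    using \<C>[OF that] by blast
  have fin': "finite D \<and> D \<subseteq> R" if "D \<in> (`) f ` \<C>" for D
    using \<C> f that by blast
  have GR: "?G \<subseteq> carrier ?R"
    using fin' by (force simp: variable_product_eq_single mpoly_ring_simps)
  have GX: "variable_product ` \<C> \<subseteq> carrier ?X"
    using fin by (force simp: variable_product_eq_single mpoly_ring_simps)
  have rename: "mpoly_rename f q \<in> Idl\<^bsub>?R\<^esub> ?G" if q: "q \<in> ?I" for q
    unfolding mpoly_rename_eq_sum_single
  proof (rule ideal_sum_closed[OF R.genideal_ideal[OF GR]])
    fix m assume m: "m \<in> Poly_Mapping.keys q"
    have "\<forall>m\<in>Poly_Mapping.keys q. Poly_Mapping.keys m \<subseteq> X \<and> (\<exists>C\<in>\<C>. C \<subseteq> Poly_Mapping.keys m)"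
      using q by (simp add: mem_Idl_variable_products_iff[OF fin])
    from bspec[OF this m] obtain C where C: "Poly_Mapping.keys m \<subseteq> X" "C \<in> \<C>" "C \<subseteq> Poly_Mapping.keys m"
      by blast
    have "f ` Poly_Mapping.keys m \<subseteq> R"
      using C(1) f by blast
    moreover have "\<exists>D\<in>(`) f ` \<C>. D \<subseteq> f ` Poly_Mapping.keys m"
      using imageI[OF C(2), of "(`) f"] image_mono[OF C(3), of f] by (rule bexI[rotated])
    ultimately have "f ` Poly_Mapping.keys m \<subseteq> R \<and> (\<exists>D\<in>(`) f ` \<C>. D \<subseteq> f ` Poly_Mapping.keys m)" ..
    then show "Poly_Mapping.single (\<Sum>a\<in>Poly_Mapping.keys m.
          Poly_Mapping.single (f a) (Poly_Mapping.lookup m a)) (Poly_Mapping.lookup q m)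
        \<in> Idl\<^bsub>?R\<^esub> ?G"
      by (subst mem_Idl_variable_products_iff[OF fin']) (simp_all add: keys_renamed_exponent)
  qed
  have "?G \<subseteq> mpoly_rename f ` ?I"
  proof
    fix g assume "g \<in> ?G"
    then obtain C where C: "C \<in> \<C>" "g = variable_product (f ` C)"
      by blast
    have "g = mpoly_rename f (variable_product C)"
      using C \<C>[OF C(1)] by (simp add: mpoly_rename_variable_product)
    then show "g \<in> mpoly_rename f ` ?I"
      using X.genideal_self[OF GX] C(1) by blast
  qed
  moreover have sub: "mpoly_rename f ` ?I \<subseteq> Idl\<^bsub>?R\<^esub> ?G"
    using rename by blast
  moreover have "Idl\<^bsub>?R\<^esub> ?G \<subseteq> carrier ?R"
    using ideal.Icarr[OF R.genideal_ideal[OF GR]] by blast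
  ultimately have "Idl\<^bsub>?R\<^esub> ?G \<subseteq> Idl\<^bsub>?R\<^esub> (mpoly_rename f ` ?I)"
    by (intro R.subset_Idl_subset) auto
  moreover have "Idl\<^bsub>?R\<^esub> (mpoly_rename f ` ?I) \<subseteq> Idl\<^bsub>?R\<^esub> ?G"
    by (rule R.genideal_minimal[OF R.genideal_ideal[OF GR] sub])
  ultimately show ?thesis
    unfolding extended_ideal_def by blast
qed


section \<open>Graphs of isotone maps\<close>

lemma poset_HomD:
  assumes "f \<in> poset_Hom P Q"
  shows "x \<in> P \<Longrightarrow> f x \<in> Q" and "x \<in> P \<Longrightarrow> y \<in> P \<Longrightarrow> x \<le> y \<Longrightarrow> f x \<le> f y"
  using assms by (auto simp: poset_Hom_def mono_on_def)

lemma letterplace_ideal_eq_Idl_graphs: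
  "(letterplace_ideal n P :: (nat \<times> 'p::order, 'k::field) mpoly set) =
    Idl\<^bsub>mpoly_ring ({1..n} \<times> P)\<^esub>
      (variable_product ` (\<lambda>p. (\<lambda>i. (i, p i)) ` {1..n}) ` poset_Hom {1..n} P)"
proof -
  have "(\<Prod>i\<in>{1..n}. mpoly_var (i, p i)) =
      (variable_product ((\<lambda>i. (i, p i)) ` {1..n}) :: (_, 'k) mpoly)" for p :: "nat \<Rightarrow> 'p"
    unfolding variable_product_def by (simp add: prod.reindex inj_on_def)
  then show ?thesis
    by (simp only: letterplace_ideal_def Setcompr_eq_image image_image)
qed

lemma coletterplace_ideal_eq_Idl_graphs:
  "(coletterplace_ideal P n :: ('p::order \<times> nat, 'k::field) mpoly set) =
    Idl\<^bsub>mpoly_ring (P \<times> {1..n})\<^esub>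
      (variable_product ` (\<lambda>\<psi>. (\<lambda>q. (q, \<psi> q)) ` P) ` poset_Hom P {1..n})"
proof -
  have "(\<Prod>q\<in>P. mpoly_var (q, \<psi> q)) =
      (variable_product ((\<lambda>q. (q, \<psi> q)) ` P) :: (_, 'k) mpoly)" for \<psi> :: "'p \<Rightarrow> nat"
    unfolding variable_product_def by (simp add: prod.reindex inj_on_def)
  then show ?thesis
    by (simp only: coletterplace_ideal_def Setcompr_eq_image image_image)
qed

text \<open>
  Strict growth in both coordinates of \<open>[n] \<times> P\<^sup>o\<^sup>p\<close> means that the coordinates in \<open>[n]\<close> and in \<open>P\<close>
  move in opposite directions.
\<close>

lemma bistrict_op_fiberD:
  assumes "bistrict_chain (op_fiber n P \<phi> r)"
    and "i \<in> {1..n}" "p \<in> P" "\<phi> (i, p) = r" and "j \<in> {1..n}" "q \<in> P" "\<phi> (j, q) = r"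
  shows "(i, p) = (j, q) \<or> i < j \<and> q < p \<or> j < i \<and> p < q"
proof -
  have mem: "(i, dual p) \<in> op_fiber n P \<phi> r" "(j, dual q) \<in> op_fiber n P \<phi> r"
    using assms unfolding op_fiber_def by blast+
  then have "(i, dual p) \<le> (j, dual q) \<or> (j, dual q) \<le> (i, dual p)"
    using assms(1) unfolding bistrict_chain_def Complete_Partial_Order.chain_def by blast
  then have "(i, dual p) = (j, dual q) \<or> (i, dual p) < (j, dual q) \<or> (j, dual q) < (i, dual p)"
    by (auto simp: order.order_iff_strict)
  moreover have "a < a' \<and> b < b'" if "(a, b) < (a', b')"
      "(a, b) \<in> op_fiber n P \<phi> r" "(a', b') \<in> op_fiber n P \<phi> r" for a a' b b'
    using assms(1) that unfolding bistrict_chain_def by fast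
  from this[OF _ mem] this[OF _ mem(2,1)]
  have "(i, dual p) < (j, dual q) \<longrightarrow> i < j \<and> q < p" "(j, dual q) < (i, dual p) \<longrightarrow> j < i \<and> p < q"
    by simp_all
  ultimately show ?thesis
    by auto
qed

text \<open>The least \<open>i\<close> with \<open>\<psi> (p i) \<le> i\<close> is a fixed point of \<open>\<psi> \<circ> p\<close>.\<close>

lemma isotone_graphs_meet:
  fixes p :: "nat \<Rightarrow> 'p::order" and \<psi> :: "'p \<Rightarrow> nat"
  assumes n: "n \<ge> 1" and p: "p \<in> poset_Hom {1..n} P" and \<psi>: "\<psi> \<in> poset_Hom P {1..n}"
  obtains i where "i \<in> {1..n}" "\<psi> (p i) = i"
proof -
  let ?f = "\<lambda>i. \<psi> (p i)"
  have f: "?f i \<in> {1..n}" if "i \<in> {1..n}" for i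
    using that by (intro poset_HomD(1)[OF \<psi>] poset_HomD(1)[OF p])
  have mono: "?f i \<le> ?f j" if "i \<in> {1..n}" "j \<in> {1..n}" "i \<le> j" for i j
    using that by (intro poset_HomD(2)[OF \<psi>] poset_HomD(2)[OF p] poset_HomD(1)[OF p])
  define i where "i = (LEAST i. i \<in> {1..n} \<and> ?f i \<le> i)"
  have "n \<in> {1..n} \<and> ?f n \<le> n"
    using f[of n] n by auto
  then have i: "i \<in> {1..n} \<and> ?f i \<le> i"
    unfolding i_def by (rule LeastI[of "\<lambda>i. i \<in> {1..n} \<and> ?f i \<le> i"])
  have "\<not> ?f i < i"
  proof
    assume "?f i < i"
    moreover have "?f i \<in> {1..n} \<and> ?f (?f i) \<le> ?f i"
      using i f mono calculation by simp
    then have "i \<le> ?f i"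
      unfolding i_def by (rule Least_le[of "\<lambda>i. i \<in> {1..n} \<and> ?f i \<le> i"])
    ultimately show False by simp
  qed
  then show ?thesis
    using that[of i] i by simp
qed

text \<open>
  Membership of \<open>q\<close> in the up-set \<open>U\<^sub>i\<close> of the introduction. The chain \<open>p\<^sub>1 \<le> \<dots> \<le> p\<^sub>i\<close> is an isotone map on
  \<open>{1..i}\<close>; for \<open>i = 0\<close> any function will do, so that \<open>U\<^sub>0\<close> contains every \<open>q\<close>.
\<close>

definition avoiding_chain_below ::
    "(nat \<times> 'p::order) set \<Rightarrow> 'p set \<Rightarrow> nat \<Rightarrow> 'p \<Rightarrow> bool" where
  "avoiding_chain_below T P i q \<longleftrightarrow>
    (\<exists>p \<in> poset_Hom {1..i} P. \<forall>j\<in>{1..i}. (j, p j) \<notin> T \<and> p j \<le> q)"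

lemma avoiding_chain_below_Suc:
  assumes "avoiding_chain_below T P i q" "q \<in> P" "(Suc i, q) \<notin> T"
  shows "avoiding_chain_below T P (Suc i) q"
proof -
  obtain p where p: "p \<in> poset_Hom {1..i} P" "\<forall>j\<in>{1..i}. (j, p j) \<notin> T \<and> p j \<le> q"
    using assms(1) unfolding avoiding_chain_below_def by blast
  have "p(Suc i := q) \<in> poset_Hom {1..Suc i} P"
    using p assms(2) by (auto simp: poset_Hom_def mono_on_def Pi_def le_Suc_eq)
  moreover have "\<forall>j\<in>{1..Suc i}. (j, (p(Suc i := q)) j) \<notin> T \<and> (p(Suc i := q)) j \<le> q"
    using p assms(3) by (auto simp: le_Suc_eq)
  ultimately show ?thesis
    unfolding avoiding_chain_below_def by blast
qed

text \<open>
  If \<open>\<psi>(q)\<close> is the first \<open>i\<close> at which no chain of length \<open>i\<close> below \<open>q\<close> avoids \<open>T\<close>, then \<open>(\<psi>(q), q)\<close>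
  lies in \<open>T\<close>, because otherwise \<open>q\<close> would prolong an avoiding chain of length \<open>\<psi>(q) - 1\<close>.
\<close>

lemma hitting_set_contains_graph:
  fixes T :: "(nat \<times> 'p::order) set"
  assumes hit: "\<And>p. p \<in> poset_Hom {1..n} P \<Longrightarrow> \<exists>i\<in>{1..n}. (i, p i) \<in> T"
  obtains \<psi> where "\<psi> \<in> poset_Hom P {1..n}" "\<And>q. q \<in> P \<Longrightarrow> (\<psi> q, q) \<in> T"
proof -
  define \<psi> where "\<psi> q = (LEAST i. \<not> avoiding_chain_below T P i q)" for q
  have none: "\<not> avoiding_chain_below T P n q" for q
    using hit unfolding avoiding_chain_below_def by blast
  have not_avoid: "\<not> avoiding_chain_below T P (\<psi> q) q" for q
    unfolding \<psi>_def by (rule LeastI, rule none)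
  have avoid: "avoiding_chain_below T P i q" if "i < \<psi> q" for i q
    using that not_less_Least unfolding \<psi>_def by blast
  have le: "\<psi> q \<le> i" if "\<not> avoiding_chain_below T P i q" for i q
    using that unfolding \<psi>_def by (rule Least_le)
  have pos: "0 < \<psi> q" for q
  proof -
    have "avoiding_chain_below T P 0 q"
      by (auto simp: avoiding_chain_below_def poset_Hom_def mono_on_def)
    then show ?thesis
      using not_avoid[of q] by (metis gr0I)
  qed
  have up: "avoiding_chain_below T P i q'" if "avoiding_chain_below T P i q" "q \<le> q'" for i q q'
    using that unfolding avoiding_chain_below_def by (meson order_trans)
  have "\<psi> q \<le> \<psi> q'" if "q \<le> q'" for q q'
    using le up not_avoid that by blast
  then have "\<psi> \<in> poset_Hom P {1..n}"
    using pos le[OF none] by (auto simp: poset_Hom_def mono_on_def Suc_le_eq)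
  moreover have "(\<psi> q, q) \<in> T" if "q \<in> P" for q
  proof (rule ccontr)
    assume "(\<psi> q, q) \<notin> T"
    moreover have "avoiding_chain_below T P (\<psi> q - 1) q"
      using pos[of q] by (intro avoid) simp
    ultimately have "avoiding_chain_below T P (\<psi> q) q"
      using avoiding_chain_below_Suc[of T P "\<psi> q - 1" q] that pos[of q] by simp
    then show False
      using not_avoid by blast
  qed
  ultimately show ?thesis
    using that by blast
qed


section \<open>Duality of letterplace and co-letterplace ideals\<close>

theorem theorem2p10:
  fixes n :: nat and P :: "'p::order set" and R :: "'r::order set"
    and \<phi> :: "nat \<times> 'p \<Rightarrow> 'r"
  assumes "n \<ge> 1" and "finite P"
    and "\<phi> \<in> poset_Hom ({1..n} \<times> P) R"
    and "\<And>r. r \<in> R \<Longrightarrow> bistrict_chain (op_fiber n P \<phi> r)"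
  shows "alexander_dual_pair R
    (extended_ideal R \<phi> (letterplace_ideal n P) :: ('r, 'k::field) mpoly set)
    (extended_ideal R (transpose_map \<phi>) (coletterplace_ideal P n))"
proof -
  let ?row = "\<lambda>p. (\<lambda>i. (i, p i)) ` {1..n}" and ?col = "\<lambda>\<psi>. (\<lambda>q. (q, \<psi> q)) ` P"
  let ?\<A> = "(`) \<phi> ` ?row ` poset_Hom {1..n} P"
  let ?\<B> = "(`) (transpose_map \<phi>) ` ?col ` poset_Hom P {1..n}"
  have \<phi>: "\<phi> (i, q) \<in> R" if "i \<in> {1..n}" "q \<in> P" for i q
    using poset_HomD(1)[OF assms(3)] that by simp
  have fiber: "(i, p) = (j, q) \<or> i < j \<and> q < p \<or> j < i \<and> p < q"
    if "i \<in> {1..n}" "p \<in> P" "j \<in> {1..n}" "q \<in> P" "\<phi> (i, p) = \<phi> (j, q)" for i j p q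
    using bistrict_op_fiberD[OF assms(4)[OF \<phi>[OF that(1,2)]] that(1,2) refl that(3,4)] that(5)
    by simp
  have rows: "finite C \<and> C \<subseteq> {1..n} \<times> P \<and> inj_on \<phi> C" if mem: "C \<in> ?row ` poset_Hom {1..n} P" for C
  proof -
    obtain p where C: "C = ?row p" and hom: "p \<in> poset_Hom {1..n} P"
      using mem by blast
    note p = poset_HomD(1)[OF hom] and mono = poset_HomD(2)[OF hom]
    have "i = j" if "i \<in> {1..n}" "j \<in> {1..n}" "\<phi> (i, p i) = \<phi> (j, p j)" for i j
      using fiber[of i "p i" j "p j"] that p mono[of i j] mono[of j i] by auto
    then have "inj_on (\<phi> \<circ> (\<lambda>i. (i, p i))) {1..n}"
      by (intro inj_onI) simp
    then have "inj_on \<phi> C"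
      unfolding C by (rule inj_on_imageI)
    then show ?thesis
      using p C by auto
  qed
  have cols: "finite C \<and> C \<subseteq> P \<times> {1..n} \<and> inj_on (transpose_map \<phi>) C"
    if mem: "C \<in> ?col ` poset_Hom P {1..n}" for C
  proof -
    obtain \<psi> where C: "C = ?col \<psi>" and hom: "\<psi> \<in> poset_Hom P {1..n}"
      using mem by blast
    note \<psi> = poset_HomD(1)[OF hom] and mono = poset_HomD(2)[OF hom]
    have "q = q'" if "q \<in> P" "q' \<in> P" "\<phi> (\<psi> q, q) = \<phi> (\<psi> q', q')" for q q'
      using fiber[of "\<psi> q" q "\<psi> q'" q'] that \<psi> mono[of q q'] mono[of q' q]
      by (auto dest: less_imp_le)
    then have "inj_on (transpose_map \<phi> \<circ> (\<lambda>q. (q, \<psi> q))) P"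
      by (intro inj_onI) (simp add: transpose_map_def)
    then have "inj_on (transpose_map \<phi>) C"
      unfolding C by (rule inj_on_imageI)
    then show ?thesis
      using \<psi> assms(2) C by auto
  qed
  have "alexander_dual_pair R
    (Idl\<^bsub>mpoly_ring R\<^esub> (variable_product ` ?\<A>) :: ('r, 'k) mpoly set)
    (Idl\<^bsub>mpoly_ring R\<^esub> (variable_product ` ?\<B>))"
  proof (rule alexander_dual_pairI)
    fix C assume "C \<in> ?\<A>"
    then obtain D where "C = \<phi> ` D" "D \<in> ?row ` poset_Hom {1..n} P"
      by (rule imageE)
    then show "finite C \<and> C \<subseteq> R"
      using rows[of D] \<phi> by auto
  next
    fix B assume "B \<in> ?\<B>"
    then obtain D where "B = transpose_map \<phi> ` D" "D \<in> ?col ` poset_Hom P {1..n}"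
      by (rule imageE)
    then show "finite B \<and> B \<subseteq> R"
      using cols[of D] \<phi> by (auto simp: transpose_map_def)
  next
    fix C B assume "C \<in> ?\<A>" and B: "B \<in> ?\<B>"
    then obtain p where p: "p \<in> poset_Hom {1..n} P" "C = \<phi> ` ?row p"
      by (elim imageE) simp
    from B obtain \<psi> where \<psi>: "\<psi> \<in> poset_Hom P {1..n}" "B = transpose_map \<phi> ` ?col \<psi>"
      by (elim imageE) simp
    obtain i where i: "i \<in> {1..n}" "\<psi> (p i) = i"
      using isotone_graphs_meet[OF assms(1) p(1) \<psi>(1)] .
    have "p i \<in> P"
      using poset_HomD(1)[OF p(1) i(1)] .
    then have "\<phi> (i, p i) \<in> B"
      using i(2) unfolding \<psi>(2) image_image transpose_map_def by (auto intro!: image_eqI[of _ _ "p i"])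
    moreover have "\<phi> (i, p i) \<in> C"
      using i(1) unfolding p(2) by blast
    ultimately show "C \<inter> B \<noteq> {}"
      by blast
  next
    fix S assume "S \<subseteq> R" and hit: "\<And>C. C \<in> ?\<A> \<Longrightarrow> C \<inter> S \<noteq> {}"
    have "\<exists>i\<in>{1..n}. (i, p i) \<in> \<phi> -` S" if "p \<in> poset_Hom {1..n} P" for p
      using hit[of "\<phi> ` ?row p"] that by blast
    then obtain \<psi> where "\<psi> \<in> poset_Hom P {1..n}" "\<And>q. q \<in> P \<Longrightarrow> (\<psi> q, q) \<in> \<phi> -` S"
      using hitting_set_contains_graph[of n P "\<phi> -` S"] by blast
    then show "\<exists>B\<in>?\<B>. B \<subseteq> S"
      by (intro bexI[of _ "transpose_map \<phi> ` ?col \<psi>"]) (auto simp: transpose_map_def)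
  qed
  moreover have "extended_ideal R \<phi> (letterplace_ideal n P :: (_, 'k) mpoly set)
      = Idl\<^bsub>mpoly_ring R\<^esub> (variable_product ` ?\<A>)"
    unfolding letterplace_ideal_eq_Idl_graphs
    by (rule extended_ideal_Idl_variable_products[OF rows]) (use \<phi> in auto)
  moreover have "extended_ideal R (transpose_map \<phi>) (coletterplace_ideal P n :: (_, 'k) mpoly set)
      = Idl\<^bsub>mpoly_ring R\<^esub> (variable_product ` ?\<B>)"
    unfolding coletterplace_ideal_eq_Idl_graphs
    by (rule extended_ideal_Idl_variable_products[OF cols]) (use \<phi> in \<open>auto simp: transpose_map_def\<close>)
  ultimately show ?thesis
    by simp
qed

end
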